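(* Let $\alpha,\beta$ be compositions, $\beta$ being a composition of $s$. Then there is an isomorphism of $\mathfrak{gl}_{\mathcal N}$-crystals $$\mathbf B(\alpha)\otimes\mathbf B(\beta)\simeq\bigoplus_{w\in\mathcal L(w_\alpha\cup w_\beta)}\mathcal E(w,\gamma_\alpha^{[s]}\cup\gamma_\beta).$$
   Context: $\mathcal N=\frac12\mathbb Z_{>0}$ with its usual linear order; elements of $\mathbb Z_{>0}$ are even, elements of $\frac12+\mathbb Z_{\ge0}$ are odd. $I=\frac12\mathbb Z_{>0}$. Weights: $\bigoplus_{b\in\mathcal N}\mathbb Z\epsilon_b$ with $(\epsilon_a,\epsilon_b)=(-1)^{|a|}\delta_{ab}$ ($|a|$ the parity), simple roots $\alpha_i=\epsilon_i-\epsilon_{i+\frac12}$, $i\in I$. A $\mathfrak{gl}_{\mathcal N}$-crystal is a set $B$ with maps $\mathrm{wt}:B\to\bigoplus\mathbb Z\epsilon_b$, $\varepsilon_i,\varphi_i:B\to\mathbb Z_{\ge0}$, $e_i,f_i:B\to B\cup\{\mathbf 0\}$ ($\mathbf 0$ a formal symbol) such that: (1) $\varphi_i(b)+\varepsilon_i(b)$ is $1$ if $(\mathrm{wt}(b),\alpha_i)\ne0$ and $0$ otherwise; (2) if $e_ib\in B$ then $\varepsilon_i(e_ib)=\varepsilon_i(b)-1$, $\varphi_i(e_ib)=\varphi_i(b)+1$, $\mathrm{wt}(e_ib)=\mathrm{wt}(b)+\alpha_i$; (3) if $f_ib\in B$ then $\varepsilon_i(f_ib)=\varepsilon_i(b)+1$,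 $\varphi_i(f_ib)=\varphi_i(b)-1$, $\mathrm{wt}(f_ib)=\mathrm{wt}(b)-\alpha_i$; (4) $f_ib=b'$ iff $b=e_ib'$. It is viewed as an $I$-colored oriented graph ($b\xrightarrow{i}b'$ iff $b'=f_ib$). An isomorphism $\simeq$ is an isomorphism of colored oriented graphs preserving $\mathrm{wt},\varepsilon_i,\varphi_i$; $\bigoplus$ is disjoint union. Tensor product: $B_1\otimes B_2=\{b_1\otimes b_2\}$, $\mathrm{wt}(b_1\otimes b_2)=\mathrm{wt}(b_1)+\mathrm{wt}(b_2)$. For $i\in\mathbb Z_{>0}$: $x_i(b_1\otimes b_2)=x_ib_1\otimes b_2$ if $(\alpha_i,\mathrm{wt}(b_1))\neq0$ and $b_1\otimes x_ib_2$ otherwise. For $i\in\frac12+\mathbb Z_{\ge0}$: $x_i(b_1\otimes b_2)=b_1\otimes x_ib_2$ if $(\alpha_i,\mathrm{wt}(b_2))\ne0$ and $x_ib_1\otimes b_2$ otherwise ($x=e,f$; $\mathbf 0\otimes b_2=b_1\otimes\mathbf 0=\mathbf 0$). $\varepsilon_i,\varphi_i$ of $b_1\otimes b_2$ are those of the factor acted on. $\mathcal N$ is a crystal with $\mathrm{wt}(b)=\epsilon_b$, $f_i(i)=i+\frac12$, $e_i(i+\frac12)=i$, all other $e_i,f_i$ giving $\mathbf 0$, and $\varepsilon_i$ (resp. $\varphi_i$) equal to $1$ if $e_i$ (resp. $f_i$) does not give $\mathbf 0$, else $0$. The set $\mathbf W$ of finite words in $\mathcal N$ is a crystal by identifying $w_1\cdots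 w_r$ with $w_1\otimes\cdots\otimes w_r$. A composition $\alpha=(\alpha_1,\dots,\alpha_t)$ is a composition of $r=\sum\alpha_i$, and is identified with its ribbon diagram: rows from top to bottom have $\alpha_1,\dots,\alpha_t$ nodes, and the leftmost node of row $i+1$ is directly below the rightmost node of row $i$. $\mathbf B(\alpha)$ is the set of quasi-ribbon tableaux of shape $\alpha$: fillings with entries in $\mathcal N$ weakly increasing along rows (left to right) and columns (top to bottom), with integers strictly increasing in each column and odd half-integers strictly increasing in each row. $\mathbf B(\alpha)$ is a crystal by identifying $T$ with its word $w(T)\in\mathbf W$ obtained by reading rows top to bottom, each row right to left. Let $x_1,\dots,x_r$ be the nodes of $\alpha$ from northwest to southeast. $w_\alpha$ denotes the totally ordered set $\{x_1<\cdots<x_r\}$, and $\gamma_\alpha(x_i)=r-k+1$ if the entry of $x_i$ is the $k$-th letter of the reading word $w(T)$. For $t\ge0$, $\gamma_\alpha^{[t]}(x_i)=\gamma_\alpha(x_i)+t$. $w_\alpha\cup w_\beta$ is the disjoint union of the two chains as a poset, with labeling $\gamma_\alpha^{[s]}\cup\gamma_\beta$ equal to $\gamma_\alpha^{[s]}$ on $w_\alpha$ and $\gamma_\beta$ on $w_\beta$. $\mathcal L(\cdot)$ is the set of linear extensions (total orders extending the partial order, on the same set). For a finite poset $P=(X,<)$ and injective labeling $\gamma:X\to\mathbb Z_{>0}$, $\mathcal E(P,\gamma)$ is the set of maps $\sigma:X\to\mathcal N$ such that for all $x<y$: $\sigma(x)\le\sigma(y)$; $\sigma(x)=\sigma(y)\in\mathbb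 Z_{>0}$ implies $\gamma(x)<\gamma(y)$; $\sigma(x)=\sigma(y)\in\frac12+\mathbb Z_{\ge0}$ implies $\gamma(x)>\gamma(y)$. It is a crystal via the embedding $\sigma\mapsto\sigma(x_1)\cdots\sigma(x_r)\in\mathbf W$, where $X=\{x_1,\dots,x_r\}$ with $\gamma(x_1)>\cdots>\gamma(x_r)$ (its image is stable under $e_i,f_i$ up to $\mathbf 0$). *)

theory Defs
  imports Complex_Main "HOL-Library.Poly_Mapping" "HOL-Library.FuncSet"
begin

section \<open>The ordered set of positive half-integers\<close>

text \<open>The type \<open>half\<close> is both the alphabet \<open>\<N>\<close> and the index set \<open>I\<close>.\<close>

typedef half = "{x :: rat. 0 < x \<and> 2 * x \<in> \<int>}"
  morphisms rat_of_half Half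
  by (rule exI[of _ 1]) simp

instantiation half :: linorder
begin

definition less_eq_half :: "half \<Rightarrow> half \<Rightarrow> bool" where
  "a \<le> b \<longleftrightarrow> rat_of_half a \<le> rat_of_half b"

definition less_half :: "half \<Rightarrow> half \<Rightarrow> bool" where
  "a < b \<longleftrightarrow> rat_of_half a < rat_of_half b"

instance
  by intro_classes (auto simp: less_eq_half_def less_half_def rat_of_half_inject)

end

definition half_succ :: "half \<Rightarrow> half" where
  "half_succ i = Half (rat_of_half i + 1 / 2)"

lemma rat_of_half_succ: "rat_of_half (half_succ i) = rat_of_half i + 1 / 2"
proof -
  have "0 < rat_of_half i" "2 * rat_of_half i \<in> \<int>"
    using rat_of_half[of i] by auto
  then have "rat_of_half i + 1 / 2 \<in> {x. 0 < x \<and> 2 * x \<in> \<int>}"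
    by (simp add: algebra_simps)
  then show ?thesis
    unfolding half_succ_def by (rule Half_inverse)
qed

definition is_integer :: "half \<Rightarrow> bool" where
  "is_integer a \<longleftrightarrow> rat_of_half a \<in> \<int>"

definition parity :: "half \<Rightarrow> nat" where
  "parity a = (if is_integer a then 0 else 1)"


section \<open>Weights\<close>

type_synonym weight = "half \<Rightarrow>\<^sub>0 int"

definition basis_wt :: "half \<Rightarrow> weight" where
  "basis_wt b = Poly_Mapping.single b 1"

definition wt_form :: "weight \<Rightarrow> weight \<Rightarrow> int" where
  "wt_form \<mu> \<nu> = (\<Sum>b\<in>Poly_Mapping.keys \<mu>.
     (- 1) ^ parity b * Poly_Mapping.lookup \<mu> b * Poly_Mapping.lookup \<nu> b)"

lemma wt_form_basis:
  "wt_form (basis_wt a) (basis_wt b) = (if a = b then (- 1) ^ parity a else 0)"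
  by (auto simp: wt_form_def basis_wt_def lookup_single when_def)

definition simple_root :: "half \<Rightarrow> weight" where
  "simple_root i = basis_wt i - basis_wt (half_succ i)"


section \<open>Crystals\<close>

text \<open>The formal symbol \<open>\<zero>\<close> is rendered as \<^const>\<open>None\<close>.\<close>

record 'b crystal =
  elts :: "'b set"
  wt :: "'b \<Rightarrow> weight"
  eps :: "half \<Rightarrow> 'b \<Rightarrow> nat"
  phi :: "half \<Rightarrow> 'b \<Rightarrow> nat"
  eop :: "half \<Rightarrow> 'b \<Rightarrow> 'b option"
  fop :: "half \<Rightarrow> 'b \<Rightarrow> 'b option"

definition gl_crystal :: "'b crystal \<Rightarrow> bool" where
  "gl_crystal B \<longleftrightarrow>
     (\<forall>i. \<forall>b\<in>elts B. \<forall>b'. eop B i b = Some b' \<or> fop B i b = Some b' \<longrightarrow> b' \<in> elts B) \<and>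
     (\<forall>i. \<forall>b\<in>elts B.
        phi B i b + eps B i b = (if wt_form (wt B b) (simple_root i) \<noteq> 0 then 1 else 0)) \<and>
     (\<forall>i. \<forall>b\<in>elts B. \<forall>b'. eop B i b = Some b' \<longrightarrow>
        int (eps B i b') = int (eps B i b) - 1 \<and>
        int (phi B i b') = int (phi B i b) + 1 \<and>
        wt B b' = wt B b + simple_root i) \<and>
     (\<forall>i. \<forall>b\<in>elts B. \<forall>b'. fop B i b = Some b' \<longrightarrow>
        int (eps B i b') = int (eps B i b) + 1 \<and>
        int (phi B i b') = int (phi B i b) - 1 \<and>
        wt B b' = wt B b - simple_root i) \<and>
     (\<forall>i. \<forall>b\<in>elts B. \<forall>b'\<in>elts B. fop B i b = Some b' \<longleftrightarrow> eop B i b' = Some b)"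

definition crystal_iso :: "('b \<Rightarrow> 'c) \<Rightarrow> 'b crystal \<Rightarrow> 'c crystal \<Rightarrow> bool" where
  "crystal_iso \<psi> B C \<longleftrightarrow>
     bij_betw \<psi> (elts B) (elts C) \<and>
     (\<forall>i. \<forall>b\<in>elts B. \<forall>b'\<in>elts B. fop B i b = Some b' \<longleftrightarrow> fop C i (\<psi> b) = Some (\<psi> b')) \<and>
     (\<forall>b\<in>elts B. wt C (\<psi> b) = wt B b) \<and>
     (\<forall>i. \<forall>b\<in>elts B. eps C i (\<psi> b) = eps B i b \<and> phi C i (\<psi> b) = phi B i b)"

definition crystal_isomorphic :: "'b crystal \<Rightarrow> 'c crystal \<Rightarrow> bool" (infix "\<simeq>\<^sub>c" 50) where
  "B \<simeq>\<^sub>c C \<longleftrightarrow> gl_crystal B \<and> gl_crystal C \<and> (\<exists>\<psi>. crystal_iso \<psi> B C)"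

definition crystal_sum :: "'w set \<Rightarrow> ('w \<Rightarrow> 'b crystal) \<Rightarrow> ('w \<times> 'b) crystal" where
  "crystal_sum L B =
     \<lparr>elts = Sigma L (\<lambda>w. elts (B w)),
      wt = (\<lambda>(w, b). wt (B w) b),
      eps = (\<lambda>i (w, b). eps (B w) i b),
      phi = (\<lambda>i (w, b). phi (B w) i b),
      eop = (\<lambda>i (w, b). map_option (Pair w) (eop (B w) i b)),
      fop = (\<lambda>i (w, b). map_option (Pair w) (fop (B w) i b))\<rparr>"

text \<open>Whether the \<open>i\<close>-th operators act on the left factor of a tensor product whose factors
  have weights \<open>\<mu>\<close> and \<open>\<nu>\<close>.\<close>

definition acts_left :: "half \<Rightarrow> weight \<Rightarrow> weight \<Rightarrow> bool" where
  "acts_left i \<mu> \<nu> \<longleftrightarrow>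
     (if is_integer i then wt_form (simple_root i) \<mu> \<noteq> 0 else wt_form (simple_root i) \<nu> = 0)"

definition crystal_tensor :: "'b crystal \<Rightarrow> 'c crystal \<Rightarrow> ('b \<times> 'c) crystal" (infixr "\<otimes>\<^sub>c" 70) where
  "B \<otimes>\<^sub>c C =
     \<lparr>elts = elts B \<times> elts C,
      wt = (\<lambda>(b, c). wt B b + wt C c),
      eps = (\<lambda>i (b, c). if acts_left i (wt B b) (wt C c) then eps B i b else eps C i c),
      phi = (\<lambda>i (b, c). if acts_left i (wt B b) (wt C c) then phi B i b else phi C i c),
      eop = (\<lambda>i (b, c). if acts_left i (wt B b) (wt C c)
               then map_option (\<lambda>b'. (b', c)) (eop B i b)
               else map_option (\<lambda>c'. (b, c')) (eop C i c)),
      fop = (\<lambda>i (b, c). if acts_left i (wt B b) (wt C c)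
               then map_option (\<lambda>b'. (b', c)) (fop B i b)
               else map_option (\<lambda>c'. (b, c')) (fop C i c))\<rparr>"


section \<open>Letters and words\<close>

definition letter_crystal :: "half crystal" where
  "letter_crystal =
     \<lparr>elts = UNIV,
      wt = basis_wt,
      eps = (\<lambda>i b. if b = half_succ i then 1 else 0),
      phi = (\<lambda>i b. if b = i then 1 else 0),
      eop = (\<lambda>i b. if b = half_succ i then Some i else None),
      fop = (\<lambda>i b. if b = i then Some (half_succ i) else None)\<rparr>"

text \<open>A word \<open>a # w\<close> is the tensor product of the letter \<open>a\<close> and the word \<open>w\<close>; the empty word
  has weight \<open>0\<close> and is annihilated by all operators.\<close>

primrec word_wt :: "half list \<Rightarrow> weight" where
  "word_wt [] = 0"
| "word_wt (a # w) = wt letter_crystal a + word_wt w"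

primrec word_eps :: "half \<Rightarrow> half list \<Rightarrow> nat" where
  "word_eps i [] = 0"
| "word_eps i (a # w) =
     (if acts_left i (wt letter_crystal a) (word_wt w) then eps letter_crystal i a
      else word_eps i w)"

primrec word_phi :: "half \<Rightarrow> half list \<Rightarrow> nat" where
  "word_phi i [] = 0"
| "word_phi i (a # w) =
     (if acts_left i (wt letter_crystal a) (word_wt w) then phi letter_crystal i a
      else word_phi i w)"

primrec word_e :: "half \<Rightarrow> half list \<Rightarrow> half list option" where
  "word_e i [] = None"
| "word_e i (a # w) =
     (if acts_left i (wt letter_crystal a) (word_wt w)
      then map_option (\<lambda>a'. a' # w) (eop letter_crystal i a)
      else map_option (\<lambda>w'. a # w') (word_e i w))"

primrec word_f :: "half \<Rightarrow> half list \<Rightarrow> half list option" where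
  "word_f i [] = None"
| "word_f i (a # w) =
     (if acts_left i (wt letter_crystal a) (word_wt w)
      then map_option (\<lambda>a'. a' # w) (fop letter_crystal i a)
      else map_option (\<lambda>w'. a # w') (word_f i w))"

definition word_crystal :: "half list crystal" where
  "word_crystal =
     \<lparr>elts = UNIV, wt = word_wt, eps = word_eps, phi = word_phi, eop = word_e, fop = word_f\<rparr>"

text \<open>The structure induced on a set \<open>X\<close> by an injection \<open>h\<close> into words. It is meaningful when
  \<open>h ` X\<close> is stable under the operators up to \<^const>\<open>None\<close>; otherwise \<^const>\<open>inv_into\<close> is
  unspecified, and closure in \<^const>\<open>gl_crystal\<close> is not available.\<close>

definition embedded_crystal :: "'b set \<Rightarrow> ('b \<Rightarrow> half list) \<Rightarrow> 'b crystal" where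
  "embedded_crystal X h =
     \<lparr>elts = X,
      wt = (\<lambda>x. wt word_crystal (h x)),
      eps = (\<lambda>i x. eps word_crystal i (h x)),
      phi = (\<lambda>i x. phi word_crystal i (h x)),
      eop = (\<lambda>i x. map_option (inv_into X h) (eop word_crystal i (h x))),
      fop = (\<lambda>i x. map_option (inv_into X h) (fop word_crystal i (h x)))\<rparr>"


section \<open>Ribbons and quasi-ribbon tableaux\<close>

definition is_composition :: "nat list \<Rightarrow> nat \<Rightarrow> bool" where
  "is_composition \<alpha> r \<longleftrightarrow> (\<forall>p\<in>set \<alpha>. 0 < p) \<and> sum_list \<alpha> = r"

text \<open>A node is a pair (row, column); rows are numbered from \<open>0\<close> downwards and columns from \<open>0\<close>
  to the right. Each row starts in the column where the previous one ends.\<close>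

type_synonym node = "nat \<times> nat"

definition ribbon_start :: "nat list \<Rightarrow> nat \<Rightarrow> nat" where
  "ribbon_start \<alpha> i = (\<Sum>j<i. \<alpha> ! j - 1)"

definition ribbon_row :: "nat list \<Rightarrow> nat \<Rightarrow> node list" where
  "ribbon_row \<alpha> i = map (Pair i) [ribbon_start \<alpha> i..<ribbon_start \<alpha> i + \<alpha> ! i]"

definition ribbon :: "nat list \<Rightarrow> node set" where
  "ribbon \<alpha> = (\<Union>i<length \<alpha>. set (ribbon_row \<alpha> i))"

definition reading_nodes :: "nat list \<Rightarrow> node list" where
  "reading_nodes \<alpha> = concat (map (\<lambda>i. rev (ribbon_row \<alpha> i)) [0..<length \<alpha>])"

definition quasi_ribbon_tableaux :: "nat list \<Rightarrow> (node \<Rightarrow> half) set" where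
  "quasi_ribbon_tableaux \<alpha> = {T \<in> extensional (ribbon \<alpha>).
     (\<forall>i j j'. (i, j) \<in> ribbon \<alpha> \<longrightarrow> (i, j') \<in> ribbon \<alpha> \<longrightarrow> j < j' \<longrightarrow>
        T (i, j) \<le> T (i, j') \<and> (\<not> is_integer (T (i, j)) \<longrightarrow> T (i, j) \<noteq> T (i, j'))) \<and>
     (\<forall>i i' j. (i, j) \<in> ribbon \<alpha> \<longrightarrow> (i', j) \<in> ribbon \<alpha> \<longrightarrow> i < i' \<longrightarrow>
        T (i, j) \<le> T (i', j) \<and> (is_integer (T (i, j)) \<longrightarrow> T (i, j) \<noteq> T (i', j)))}"

definition tableau_word :: "nat list \<Rightarrow> (node \<Rightarrow> half) \<Rightarrow> half list" where
  "tableau_word \<alpha> T = map T (reading_nodes \<alpha>)"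

definition ribbon_crystal :: "nat list \<Rightarrow> (node \<Rightarrow> half) crystal" (\<open>\<^bold>B\<close>) where
  "\<^bold>B \<alpha> = embedded_crystal (quasi_ribbon_tableaux \<alpha>) (tableau_word \<alpha>)"


section \<open>Labelled posets\<close>

text \<open>Partial orders are reflexive relations on an explicit ground set.\<close>

definition ribbon_chain :: "nat list \<Rightarrow> node rel" where
  "ribbon_chain \<alpha> =
     {(x, y). x \<in> ribbon \<alpha> \<and> y \<in> ribbon \<alpha> \<and> fst x \<le> fst y \<and> snd x \<le> snd y}"

definition ribbon_label :: "nat list \<Rightarrow> node \<Rightarrow> nat" where
  "ribbon_label \<alpha> x = (let r = sum_list \<alpha> in
     THE l. \<exists>k\<in>{1..r}. reading_nodes \<alpha> ! (k - 1) = x \<and> l = r - k + 1)"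

definition shift_label :: "nat \<Rightarrow> ('a \<Rightarrow> nat) \<Rightarrow> 'a \<Rightarrow> nat" where
  "shift_label t \<gamma> x = \<gamma> x + t"

definition poset_union :: "'a rel \<Rightarrow> 'b rel \<Rightarrow> ('a + 'b) rel" where
  "poset_union P Q = map_prod Inl Inl ` P \<union> map_prod Inr Inr ` Q"

definition linear_extensions :: "'a set \<Rightarrow> 'a rel \<Rightarrow> 'a rel set" where
  "linear_extensions X P = {w. linear_order_on X w \<and> P \<subseteq> w}"

definition poset_fillings :: "'a set \<Rightarrow> 'a rel \<Rightarrow> ('a \<Rightarrow> nat) \<Rightarrow> ('a \<Rightarrow> half) set" where
  "poset_fillings X P \<gamma> = {\<sigma> \<in> extensional X. \<forall>x y. (x, y) \<in> P \<and> x \<noteq> y \<longrightarrow>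
     \<sigma> x \<le> \<sigma> y \<and>
     (\<sigma> x = \<sigma> y \<and> is_integer (\<sigma> x) \<longrightarrow> \<gamma> x < \<gamma> y) \<and>
     (\<sigma> x = \<sigma> y \<and> \<not> is_integer (\<sigma> x) \<longrightarrow> \<gamma> x > \<gamma> y)}"

definition filling_word :: "'a set \<Rightarrow> ('a \<Rightarrow> nat) \<Rightarrow> ('a \<Rightarrow> half) \<Rightarrow> half list" where
  "filling_word X \<gamma> \<sigma> = map \<sigma> (rev (sorted_key_list_of_set \<gamma> X))"

definition poset_crystal :: "'a set \<Rightarrow> 'a rel \<Rightarrow> ('a \<Rightarrow> nat) \<Rightarrow> ('a \<Rightarrow> half) crystal" (\<open>\<E>\<close>) where
  "\<E> X P \<gamma> = embedded_crystal (poset_fillings X P \<gamma>) (filling_word X \<gamma>)"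

end

theory Submission
  imports Defs
begin

text \<open>In a word, \<open>e\<^sub>i\<close> and \<open>f\<^sub>i\<close> act on a single letter: among the letters \<open>i\<close> and \<open>i + 1/2\<close>, the
  leftmost one if \<open>i\<close> is an integer and the rightmost one otherwise. For a labelled poset this is
  the relevant node of largest, respectively smallest, label, so changing its entry preserves the
  filling conditions for every poset. A crystal embedded in the words is thus determined by its set
  of words, and it suffices to compare the words of the two sides. A quasi-ribbon tableau is a
  filling of the chain of nodes of its ribbon, and concatenating the words of two tableaux gives
  the word of the filling of the disjoint union of the two chains, because all shifted labels of
  \<open>\<alpha>\<close> exceed those of \<open>\<beta>\<close>. Finally, as in Stanley's theory of \<open>P\<close>-partitions, every filling of
  a poset is a filling of exactly one of its linear extensions: the one that orders the nodes by
  their entries and breaks ties by labels.\<close>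

section \<open>Half-integers and the words they form\<close>

lemma half_less_succ: "i < half_succ i"
  by (simp add: less_half_def rat_of_half_succ)

lemma half_succ_neq [simp]: "half_succ i \<noteq> i" "i \<noteq> half_succ i"
  using half_less_succ[of i] by auto

text \<open>Doubling turns half-integers into integers, where \<open>m < n\<close> means
  \<open>m + 1 \<le> n\<close>; so no letter lies between \<open>i\<close> and
  \<open>half_succ i\<close>.\<close>

lemma half_succ_le: "half_succ i \<le> a" if "i < a"
proof -
  have "2 * rat_of_half i \<in> \<int>" "2 * rat_of_half a \<in> \<int>"
    using rat_of_half[of i] rat_of_half[of a] by auto
  then obtain m n :: int where m: "2 * rat_of_half i = of_int m" and n: "2 * rat_of_half a = of_int n"
    by (auto elim!: Ints_cases)
  have "(of_int m :: rat) < of_int n"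
    using that m n by (simp add: less_half_def)
  then have "(of_int (m + 1) :: rat) \<le> of_int n"
    by (simp only: of_int_less_iff of_int_le_iff)
  then show ?thesis
    using m n by (simp add: less_eq_half_def rat_of_half_succ)
qed

lemma is_integer_half_succ: "is_integer (half_succ i) \<longleftrightarrow> \<not> is_integer i"
proof -
  have "2 * rat_of_half i \<in> \<int>"
    using rat_of_half[of i] by auto
  then obtain m :: int where m: "2 * rat_of_half i = of_int m"
    by (auto elim!: Ints_cases)
  have "is_integer i \<longleftrightarrow> even m"
  proof
    assume "is_integer i"
    then obtain k where "rat_of_half i = of_int k"
      by (auto simp: is_integer_def elim!: Ints_cases)
    then have "(of_int m :: rat) = of_int (2 * k)"
      using m by simp
    then show "even m"
      by (simp only: of_int_eq_iff) simp
  next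
    assume "even m"
    then obtain k where "m = 2 * k" ..
    then have "rat_of_half i = of_int k"
      using m by simp
    then show "is_integer i"
      by (simp add: is_integer_def)
  qed
  moreover have "is_integer (half_succ i) \<longleftrightarrow> odd m"
  proof
    assume "is_integer (half_succ i)"
    then obtain k where "rat_of_half i + 1 / 2 = of_int k"
      by (auto simp: is_integer_def rat_of_half_succ elim!: Ints_cases)
    then have "(of_int m :: rat) = of_int (2 * k - 1)"
      using m by simp
    then show "odd m"
      by (simp only: of_int_eq_iff) simp
  next
    assume "odd m"
    then obtain k where "m = 2 * k + 1"
      by (elim oddE)
    then have "rat_of_half i + 1 / 2 = of_int (k + 1)"
      using m by simp
    then show "is_integer (half_succ i)"
      by (simp add: is_integer_def rat_of_half_succ)
  qed
  ultimately show ?thesis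
    by simp
qed

text \<open>A word has nonzero pairing with \<open>\<alpha>\<^sub>i\<close> iff it contains an active letter: both letters
  contribute with the same sign because their parities differ.\<close>

definition active :: "half \<Rightarrow> half \<Rightarrow> bool" where
  "active i a \<longleftrightarrow> a = i \<or> a = half_succ i"

lemma active_self [simp]: "active i i" "active i (half_succ i)"
  by (simp_all add: active_def)

section \<open>Pairing of words with simple roots\<close>

lemma lookup_simple_root:
  "Poly_Mapping.lookup (simple_root i) b = (if b = i then 1 else if b = half_succ i then - 1 else 0)"
  by (auto simp: simple_root_def basis_wt_def lookup_minus lookup_single when_def)

lemma keys_simple_root: "Poly_Mapping.keys (simple_root i) = {i, half_succ i}"
  by (auto simp: in_keys_iff lookup_simple_root split: if_splits)

lemma parity_half_succ: "(- 1 :: int) ^ parity (half_succ i) = - ((- 1) ^ parity i)"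
  by (simp add: parity_def is_integer_half_succ)

lemma wt_form_simple_root_left:
  "wt_form (simple_root i) \<nu> =
     (- 1) ^ parity i * (Poly_Mapping.lookup \<nu> i + Poly_Mapping.lookup \<nu> (half_succ i))"
  by (simp add: wt_form_def keys_simple_root lookup_simple_root parity_half_succ algebra_simps)

lemma wt_form_simple_root_right:
  "wt_form \<mu> (simple_root i) =
     (- 1) ^ parity i * (Poly_Mapping.lookup \<mu> i + Poly_Mapping.lookup \<mu> (half_succ i))"
proof -
  \<comment> \<open>\<open>wt_form\<close> sums over the support of its first argument, here \<mu>;
    the sum is enlarged to both supports and then cut down to that of the root.\<close>
  have "wt_form \<mu> (simple_root i) = (\<Sum>b\<in>Poly_Mapping.keys \<mu> \<union> {i, half_succ i}.
      (- 1) ^ parity b * Poly_Mapping.lookup \<mu> b * Poly_Mapping.lookup (simple_root i) b)"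
    unfolding wt_form_def by (rule sum.mono_neutral_left) (auto simp: in_keys_iff)
  also have "\<dots> = (\<Sum>b\<in>{i, half_succ i}.
      (- 1) ^ parity b * Poly_Mapping.lookup \<mu> b * Poly_Mapping.lookup (simple_root i) b)"
    by (rule sum.mono_neutral_right) (auto simp: lookup_simple_root)
  also have "\<dots> = (- 1) ^ parity i * (Poly_Mapping.lookup \<mu> i + Poly_Mapping.lookup \<mu> (half_succ i))"
    by (simp add: lookup_simple_root parity_half_succ algebra_simps)
  finally show ?thesis .
qed

lemma lookup_word_wt: "Poly_Mapping.lookup (word_wt w) b = int (count_list w b)"
  by (induction w) (auto simp: lookup_add letter_crystal_def basis_wt_def lookup_single)

lemma word_wt_append: "word_wt (u @ v) = word_wt u + word_wt v"
  by (induction u) (simp_all add: add.assoc)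

lemma wt_form_word_wt_eq_0_iff:
  "wt_form (simple_root i) (word_wt w) = 0 \<longleftrightarrow> (\<forall>a\<in>set w. \<not> active i a)"
  "wt_form (word_wt w) (simple_root i) = 0 \<longleftrightarrow> (\<forall>a\<in>set w. \<not> active i a)"
proof -
  \<comment> \<open>Multiplicities are natural numbers, so the two contributions cannot
    cancel.\<close>
  have "count_list w i + count_list w (half_succ i) = 0 \<longleftrightarrow> (\<forall>a\<in>set w. \<not> active i a)"
    by (auto simp: active_def count_list_0_iff)
  then show "wt_form (simple_root i) (word_wt w) = 0 \<longleftrightarrow> (\<forall>a\<in>set w. \<not> active i a)"
    "wt_form (word_wt w) (simple_root i) = 0 \<longleftrightarrow> (\<forall>a\<in>set w. \<not> active i a)"
    by (simp_all add: wt_form_simple_root_left wt_form_simple_root_right lookup_word_wt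
        flip: of_nat_add)
qed

lemma acts_left_word:
  "acts_left i (word_wt u) (word_wt v) \<longleftrightarrow>
     (if is_integer i then \<exists>a\<in>set u. active i a else \<forall>a\<in>set v. \<not> active i a)"
  by (auto simp: acts_left_def wt_form_word_wt_eq_0_iff)

lemma acts_left_letter:
  "acts_left i (basis_wt a) (word_wt v) \<longleftrightarrow>
     (if is_integer i then active i a else \<forall>a\<in>set v. \<not> active i a)"
  using acts_left_word[of i "[a]" v] by (simp add: letter_crystal_def)

lemmas word_op_simps = letter_crystal_def acts_left_letter

section \<open>Crystal operators on words\<close>

lemma word_ops_inactive:
  assumes "\<forall>a\<in>set w. \<not> active i a"
  shows "word_e i w = None" "word_f i w = None" "word_eps i w = 0" "word_phi i w = 0"
  using assms by (induction w) (auto simp: word_op_simps active_def)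

text \<open>Associativity of the tensor rule: the recursion peels off one letter, whereas here the
  cut is anywhere. Both select the leftmost active letter for integral \<open>i\<close> and the
  rightmost one otherwise.\<close>

lemma word_ops_append:
  "word_e i (u @ v) = (if acts_left i (word_wt u) (word_wt v)
     then map_option (\<lambda>u'. u' @ v) (word_e i u) else map_option (\<lambda>v'. u @ v') (word_e i v))"
  "word_f i (u @ v) = (if acts_left i (word_wt u) (word_wt v)
     then map_option (\<lambda>u'. u' @ v) (word_f i u) else map_option (\<lambda>v'. u @ v') (word_f i v))"
  "word_eps i (u @ v) = (if acts_left i (word_wt u) (word_wt v) then word_eps i u else word_eps i v)"
  "word_phi i (u @ v) = (if acts_left i (word_wt u) (word_wt v) then word_phi i u else word_phi i v)"
proof (induction u)
  case Nil
  show "word_e i ([] @ v) = (if acts_left i (word_wt []) (word_wt v)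
     then map_option (\<lambda>u'. u' @ v) (word_e i []) else map_option (\<lambda>v'. [] @ v') (word_e i v))"
  and "word_f i ([] @ v) = (if acts_left i (word_wt []) (word_wt v)
     then map_option (\<lambda>u'. u' @ v) (word_f i []) else map_option (\<lambda>v'. [] @ v') (word_f i v))"
  and "word_eps i ([] @ v) = (if acts_left i (word_wt []) (word_wt v) then word_eps i [] else word_eps i v)"
  and "word_phi i ([] @ v) = (if acts_left i (word_wt []) (word_wt v) then word_phi i [] else word_phi i v)"
    \<comment> \<open>For empty \<open>u\<close> the rule still picks the left factor when
      \<open>i\<close> is not integral and \<open>v\<close> has no active letter; then both sides
      are \<open>None\<close> or 0.\<close>
    using word_ops_inactive[of v i] acts_left_word[of i "[]" v]
    by (auto simp: option.map_ident)
next
  case (Cons a u)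
  show "word_e i ((a # u) @ v) = (if acts_left i (word_wt (a # u)) (word_wt v)
     then map_option (\<lambda>u'. u' @ v) (word_e i (a # u)) else map_option (\<lambda>v'. (a # u) @ v') (word_e i v))"
  and "word_f i ((a # u) @ v) = (if acts_left i (word_wt (a # u)) (word_wt v)
     then map_option (\<lambda>u'. u' @ v) (word_f i (a # u)) else map_option (\<lambda>v'. (a # u) @ v') (word_f i v))"
  and "word_eps i ((a # u) @ v) =
     (if acts_left i (word_wt (a # u)) (word_wt v) then word_eps i (a # u) else word_eps i v)"
  and "word_phi i ((a # u) @ v) =
     (if acts_left i (word_wt (a # u)) (word_wt v) then word_phi i (a # u) else word_phi i v)"
    using Cons acts_left_word[of i "a # u" v] acts_left_word[of i u v]
    unfolding append_Cons word_e.simps word_f.simps word_eps.simps word_phi.simps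
    by (auto simp: word_op_simps option.map_comp comp_def simp del: word_wt.simps)
qed

text \<open>The position between \<open>u\<close> and \<open>v\<close> is the one on which the \<open>i\<close>-th operators act.\<close>

definition active_split :: "half \<Rightarrow> half list \<Rightarrow> half list \<Rightarrow> bool" where
  "active_split i u v \<longleftrightarrow> (\<forall>a\<in>set (if is_integer i then u else v). \<not> active i a)"

text \<open>Treats \<open>word_e\<close> and \<open>word_f\<close> at once: \<open>g\<close>
  replaces \<open>a\<close> by \<open>b\<close>, which are the two active letters in either order.
  The tensor rule hits the first letter or passes to the tail, which drives the induction.\<close>

lemma word_step_iff:
  fixes g :: "half list \<Rightarrow> half list option"
  assumes ab: "active i a" "active i b" "a \<noteq> b"
    and nil: "g [] = None"
    and cons: "\<And>c w. g (c # w) = (if acts_left i (basis_wt c) (word_wt w)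
      then map_option (\<lambda>c'. c' # w) (if c = a then Some b else None)
      else map_option (\<lambda>w'. c # w') (g w))"
  shows "g w = Some w' \<longleftrightarrow> (\<exists>u v. w = u @ a # v \<and> w' = u @ b # v \<and> active_split i u v)"
proof (induction w arbitrary: w')
  case Nil
  then show ?case by (simp add: nil)
next
  case (Cons c w)
  have split: "(\<exists>u v. c # w = u @ a # v \<and> w' = u @ b # v \<and> active_split i u v) \<longleftrightarrow>
    (c = a \<and> w' = b # w \<and> active_split i [] w) \<or>
    (\<exists>u v. w = u @ a # v \<and> w' = c # u @ b # v \<and> active_split i (c # u) v)"
    by (auto simp: Cons_eq_append_conv) (metis append_Cons)+
  show ?case
  proof (cases "is_integer i")
    case True
    then show ?thesis
      unfolding split using ab by (auto simp: cons acts_left_letter active_split_def Cons.IH)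
  next
    case False
    then show ?thesis
      unfolding split using ab by (auto simp: cons acts_left_letter active_split_def Cons.IH)
  qed
qed

lemma word_f_iff:
  "word_f i w = Some w' \<longleftrightarrow>
     (\<exists>u v. w = u @ i # v \<and> w' = u @ half_succ i # v \<and> active_split i u v)"
  by (rule word_step_iff) (simp_all add: letter_crystal_def)

lemma word_e_iff:
  "word_e i w = Some w' \<longleftrightarrow>
     (\<exists>u v. w = u @ half_succ i # v \<and> w' = u @ i # v \<and> active_split i u v)"
  by (rule word_step_iff) (simp_all add: letter_crystal_def)

text \<open>Exchanging the two active letters at one place leaves \<open>u\<close> and
  \<open>v\<close>, hence \<open>active_split\<close>, unchanged.\<close>

lemma word_f_iff_e: "word_f i w = Some w' \<longleftrightarrow> word_e i w' = Some w"
  unfolding word_f_iff word_e_iff by auto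

lemma word_eps_eq: "word_eps i w = (if word_e i w = None then 0 else 1)"
  by (induction w) (auto simp: letter_crystal_def)

lemma word_phi_eq: "word_phi i w = (if word_f i w = None then 0 else 1)"
  by (induction w) (auto simp: letter_crystal_def)

lemma word_phi_add_eps:
  "word_phi i w + word_eps i w = (if \<exists>a\<in>set w. active i a then 1 else 0)"
  by (induction w) (auto simp: word_op_simps active_def word_ops_inactive)

lemma word_wt_e: "word_e i w = Some w' \<Longrightarrow> word_wt w' = word_wt w + simple_root i"
  by (auto simp: word_e_iff word_wt_append letter_crystal_def simple_root_def)

section \<open>Crystals of words\<close>

text \<open>An embedding of \<open>B\<close> into the crystal of words with stable image.
  \<open>rel_option\<close> says at once that an operator vanishes on both sides or on neither, that
  its result stays in \<open>B\<close>, and which word it has.\<close>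

definition word_model :: "'b crystal \<Rightarrow> ('b \<Rightarrow> half list) \<Rightarrow> bool" where
  "word_model B h \<longleftrightarrow> inj_on h (elts B) \<and>
     (\<forall>b\<in>elts B. wt B b = word_wt (h b) \<and>
       (\<forall>i. eps B i b = word_eps i (h b) \<and> phi B i b = word_phi i (h b) \<and>
         rel_option (\<lambda>b' w. b' \<in> elts B \<and> w = h b') (eop B i b) (word_e i (h b)) \<and>
         rel_option (\<lambda>b' w. b' \<in> elts B \<and> w = h b') (fop B i b) (word_f i (h b))))"

lemma word_modelD:
  assumes "word_model B h" "b \<in> elts B"
  shows "wt B b = word_wt (h b)" "eps B i b = word_eps i (h b)" "phi B i b = word_phi i (h b)"
    and "rel_option (\<lambda>b' w. b' \<in> elts B \<and> w = h b') (eop B i b) (word_e i (h b))"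
    and "rel_option (\<lambda>b' w. b' \<in> elts B \<and> w = h b') (fop B i b) (word_f i (h b))"
  using assms by (auto simp: word_model_def)

lemma word_model_inj: "word_model B h \<Longrightarrow> inj_on h (elts B)"
  by (simp add: word_model_def)

lemma word_model_eop:
  assumes "word_model B h" "b \<in> elts B"
  shows "eop B i b = Some b' \<longleftrightarrow> b' \<in> elts B \<and> word_e i (h b) = Some (h b')"
  using word_modelD(4)[OF assms, of i] word_model_inj[OF assms(1)]
  by (auto simp: option_rel_Some1 option_rel_Some2 dest: inj_onD)

lemma word_model_fop:
  assumes "word_model B h" "b \<in> elts B"
  shows "fop B i b = Some b' \<longleftrightarrow> b' \<in> elts B \<and> word_f i (h b) = Some (h b')"
  using word_modelD(5)[OF assms, of i] word_model_inj[OF assms(1)]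
  by (auto simp: option_rel_Some1 option_rel_Some2 dest: inj_onD)

lemma gl_crystal_word_model:
  assumes B: "word_model B h"
  shows "gl_crystal B"
proof -
  have e: "int (eps B i b') = int (eps B i b) - 1" "int (phi B i b') = int (phi B i b) + 1"
    "wt B b' = wt B b + simple_root i"
    if "b \<in> elts B" "b' \<in> elts B" "word_e i (h b) = Some (h b')" for i b b'
  proof -
    have "\<exists>a\<in>set (h b). active i a" "\<exists>a\<in>set (h b'). active i a"
      using that(3) by (auto simp: word_e_iff)
    \<comment> \<open>So \<open>b\<close> has \<open>eps\<close> equal to 1 and \<open>b'\<close>
      has \<open>phi\<close> equal to 1; each sum of \<open>phi\<close> and \<open>eps\<close> is 1,
      hence the two other values are 0.\<close>
    moreover have "word_f i (h b') = Some (h b)"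
      using that(3) by (simp add: word_f_iff_e)
    ultimately show "int (eps B i b') = int (eps B i b) - 1" "int (phi B i b') = int (phi B i b) + 1"
      using that word_phi_add_eps[of i "h b"] word_phi_add_eps[of i "h b'"]
      by (auto simp: word_modelD[OF B] word_eps_eq word_phi_eq)
    show "wt B b' = wt B b + simple_root i"
      using that by (simp add: word_modelD[OF B] word_wt_e)
  qed
  have "phi B i b + eps B i b = (if wt_form (wt B b) (simple_root i) \<noteq> 0 then 1 else 0)"
    if "b \<in> elts B" for i b
    using that by (auto simp: word_modelD[OF B] word_phi_add_eps wt_form_word_wt_eq_0_iff)
  \<comment> \<open>Lowering \<open>b\<close> to \<open>b'\<close> is raising \<open>b'\<close> to
    \<open>b\<close>, so \<open>e\<close> applies with the roles exchanged.\<close>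
  moreover have "int (eps B i b') = int (eps B i b) + 1" "int (phi B i b') = int (phi B i b) - 1"
    "wt B b' = wt B b - simple_root i"
    if "b \<in> elts B" "b' \<in> elts B" "word_e i (h b') = Some (h b)" for i b b'
    using e[OF that(2,1,3)] by simp_all
  ultimately show ?thesis
    unfolding gl_crystal_def
    using e
    by (auto simp: word_model_eop[OF B] word_model_fop[OF B] word_f_iff_e)
qed

text \<open>Elements with the same word are matched; weights, \<open>eps\<close>, \<open>phi\<close>
  and operators are all computed from the word.\<close>

lemma word_models_isomorphic:
  assumes B: "word_model B h" and C: "word_model C k" and eq: "h ` elts B = k ` elts C"
  shows "B \<simeq>\<^sub>c C"
proof -
  define \<psi> where "\<psi> = inv_into (elts C) k \<circ> h"
  have \<psi>: "\<psi> b \<in> elts C" "k (\<psi> b) = h b" if "b \<in> elts B" for b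
  proof -
    have "h b \<in> k ` elts C"
      using that eq by blast
    then show "\<psi> b \<in> elts C" "k (\<psi> b) = h b"
      by (simp_all add: \<psi>_def inv_into_into f_inv_into_f)
  qed
  have "bij_betw h (elts B) (k ` elts C)"
    using word_model_inj[OF B] eq by (simp add: bij_betw_def)
  moreover have "bij_betw (inv_into (elts C) k) (k ` elts C) (elts C)"
    using word_model_inj[OF C] by (simp add: bij_betw_inv_into inj_on_imp_bij_betw)
  ultimately have "bij_betw \<psi> (elts B) (elts C)"
    unfolding \<psi>_def by (rule bij_betw_trans)
  then have "crystal_iso \<psi> B C"
    unfolding crystal_iso_def
    by (auto simp: \<psi> word_model_fop[OF B] word_model_fop[OF C] word_modelD[OF B] word_modelD[OF C])
  then show ?thesis
    using gl_crystal_word_model[OF B] gl_crystal_word_model[OF C]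
    by (auto simp: crystal_isomorphic_def)
qed

text \<open>Stability of the image makes every value of \<open>inv_into\<close> in
  \<open>embedded_crystal\<close> a genuine preimage.\<close>

lemma word_model_embedded:
  assumes inj: "inj_on h X"
    and e: "\<And>i x w. x \<in> X \<Longrightarrow> word_e i (h x) = Some w \<Longrightarrow> w \<in> h ` X"
    and f: "\<And>i x w. x \<in> X \<Longrightarrow> word_f i (h x) = Some w \<Longrightarrow> w \<in> h ` X"
  shows "word_model (embedded_crystal X h) h"
proof -
  have "rel_option (\<lambda>b' w. b' \<in> X \<and> w = h b') (map_option (inv_into X h) z) z"
    if "\<And>w. z = Some w \<Longrightarrow> w \<in> h ` X" for z
    using that by (cases z) (auto simp: inv_into_into f_inv_into_f)
  then show ?thesis
    using assms by (simp add: word_model_def embedded_crystal_def word_crystal_def)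
qed

text \<open>The fixed length \<open>n\<close> tells where to cut a concatenated word, so the coding
  is injective; \<open>word_ops_append\<close> matches the operators.\<close>

lemma word_model_tensor:
  assumes B: "word_model B h" and C: "word_model C k"
    and len: "\<And>b. b \<in> elts B \<Longrightarrow> length (h b) = n"
  shows "word_model (B \<otimes>\<^sub>c C) (\<lambda>(b, c). h b @ k c)"
proof -
  have "inj_on (\<lambda>(b, c). h b @ k c) (elts B \<times> elts C)"
    using word_model_inj[OF B] word_model_inj[OF C] len by (auto simp: inj_on_def)
  moreover have "rel_option (\<lambda>b' w. b' \<in> elts B \<times> elts C \<and> w = (case b' of (b, c) \<Rightarrow> h b @ k c))
      (map_option (\<lambda>b'. (b', c)) z) (map_option (\<lambda>u. u @ k c) z')"
    if "rel_option (\<lambda>b' w. b' \<in> elts B \<and> w = h b') z z'" "c \<in> elts C" for z z' c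
    using that by (cases z; cases z') auto
  moreover have "rel_option (\<lambda>b' w. b' \<in> elts B \<times> elts C \<and> w = (case b' of (b, c) \<Rightarrow> h b @ k c))
      (map_option (\<lambda>c'. (b, c')) z) (map_option (\<lambda>v. h b @ v) z')"
    if "rel_option (\<lambda>b' w. b' \<in> elts C \<and> w = k b') z z'" "b \<in> elts B" for z z' b
    using that by (cases z; cases z') auto
  ultimately show ?thesis
    unfolding word_model_def crystal_tensor_def
    by (auto simp: word_modelD[OF B] word_modelD[OF C] word_ops_append word_wt_append)
qed

text \<open>The coding forgets the index of the summand, so injectivity requires that distinct
  summands share no word.\<close>

lemma word_model_sum:
  assumes B: "\<And>w. w \<in> L \<Longrightarrow> word_model (B w) h"
    and disj: "\<And>w w' b b'. w \<in> L \<Longrightarrow> w' \<in> L \<Longrightarrow> b \<in> elts (B w) \<Longrightarrow> b' \<in> elts (B w') \<Longrightarrow>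
      h b = h b' \<Longrightarrow> w = w'"
  shows "word_model (crystal_sum L B) (h \<circ> snd)"
proof -
  have "inj_on (h \<circ> snd) (Sigma L (\<lambda>w. elts (B w)))"
  proof (rule inj_onI, clarify)
    fix w b w' b'
    assume *: "w \<in> L" "w' \<in> L" "b \<in> elts (B w)" "b' \<in> elts (B w')"
      "(h \<circ> snd) (w, b) = (h \<circ> snd) (w', b')"
    then have "w = w'"
      by (intro disj[of w w' b b']) auto
    then show "w = w' \<and> b = b'"
      using * word_model_inj[OF B] by (auto dest: inj_onD)
  qed
  moreover have "rel_option (\<lambda>b' u. b' \<in> Sigma L (\<lambda>w. elts (B w)) \<and> u = (h \<circ> snd) b')
      (map_option (Pair w) z) z'"
    if "rel_option (\<lambda>b' u. b' \<in> elts (B w) \<and> u = h b') z z'" "w \<in> L" for z z' w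
    using that by (cases z; cases z') auto
  ultimately show ?thesis
    unfolding word_model_def crystal_sum_def
    by (auto simp: word_modelD[OF B])
qed

section \<open>Fillings of labelled posets\<close>

lemma poset_fillingsD:
  assumes "\<sigma> \<in> poset_fillings X P \<gamma>" "(x, y) \<in> P" "x \<noteq> y"
  shows "\<sigma> x \<le> \<sigma> y" "\<sigma> x = \<sigma> y \<Longrightarrow> is_integer (\<sigma> x) \<Longrightarrow> \<gamma> x < \<gamma> y"
    "\<sigma> x = \<sigma> y \<Longrightarrow> \<not> is_integer (\<sigma> x) \<Longrightarrow> \<gamma> y < \<gamma> x"
  using assms by (auto simp: poset_fillings_def)

text \<open>No letter lies between the two active ones, so the comparison of \<open>x\<close> with
  inactive entries is unaffected. Against another active node, extremality of the label of
  \<open>x\<close> excludes the ties that the change would break and supplies the label comparison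
  for those that it creates.\<close>

lemma poset_fillings_update:
  assumes \<sigma>: "\<sigma> \<in> poset_fillings X P \<gamma>" and P: "P \<subseteq> X \<times> X"
    and x: "x \<in> X" "active i (\<sigma> x)" and b: "active i b"
    and extreme: "\<And>z. z \<in> X \<Longrightarrow> z \<noteq> x \<Longrightarrow> active i (\<sigma> z) \<Longrightarrow>
      if is_integer i then \<gamma> z < \<gamma> x else \<gamma> x < \<gamma> z"
  shows "\<sigma>(x := b) \<in> poset_fillings X P \<gamma>"
proof -
  let ?\<tau> = "\<sigma>(x := b)"
  have succ: "i < a \<Longrightarrow> a \<noteq> half_succ i \<Longrightarrow> half_succ i < a" for a
    using half_succ_le[of i a] by auto
  have x_cases: "\<sigma> x = i \<or> \<sigma> x = half_succ i" and b_cases: "b = i \<or> b = half_succ i"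
    using x b by (auto simp: active_def)
  have "?\<tau> u \<le> ?\<tau> v \<and> (?\<tau> u = ?\<tau> v \<longrightarrow> (if is_integer (?\<tau> u) then \<gamma> u < \<gamma> v else \<gamma> v < \<gamma> u))"
    if uv: "(u, v) \<in> P" "u \<noteq> v" for u v
  proof -
    note D = poset_fillingsD[OF \<sigma> uv]
    have X: "u \<in> X" "v \<in> X"
      using uv P by auto
    consider (low) "u = x" | (high) "v = x" | (other) "u \<noteq> x" "v \<noteq> x"
      by blast
    then show ?thesis
    proof cases
      case low
      \<comment> \<open>An entry above \<open>x\<close> is active or beyond both active letters;
        labels matter only in the first case.\<close>
      then have v: "v \<noteq> x" "\<sigma> v = i \<or> \<sigma> v = half_succ i \<or> half_succ i < \<sigma> v"
        using D(1) uv x_cases succ[of "\<sigma> v"] half_less_succ[of i] by fastforce+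
      show ?thesis
        using x_cases b_cases v(2)
        by (elim disjE; use low D v(1) extreme[OF X(2) v(1)] half_less_succ[of i] is_integer_half_succ[of i]
            in \<open>simp split: if_splits\<close>)
    next
      case high
      then have u: "u \<noteq> x" "\<sigma> u < i \<or> \<sigma> u = i \<or> \<sigma> u = half_succ i"
        using D(1) uv x_cases succ[of "\<sigma> u"] half_less_succ[of i] by fastforce+
      have "\<sigma> u < i \<Longrightarrow> \<sigma> u \<le> half_succ i"
        by (rule less_imp_le[OF less_trans[OF _ half_less_succ]])
      then show ?thesis
        using x_cases b_cases u(2)
        by (elim disjE; use high D u(1) extreme[OF X(1) u(1)] half_less_succ[of i] is_integer_half_succ[of i]
            in \<open>simp split: if_splits\<close>)
    next
      case other
      then show ?thesis
        using D by simp
    qed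
  qed
  moreover have "?\<tau> \<in> extensional X"
    using \<sigma> x by (auto simp: poset_fillings_def extensional_def)
  ultimately show ?thesis
    unfolding poset_fillings_def by (auto simp del: fun_upd_apply split: if_splits)
qed

lemma (in linorder) rev_sorted_key_list_of_set:
  assumes "finite X" "inj_on \<gamma> X"
  shows "set (rev (sorted_key_list_of_set \<gamma> X)) = X"
    and "sorted_wrt (\<lambda>x y. \<gamma> y < \<gamma> x) (rev (sorted_key_list_of_set \<gamma> X))"
    and "length (sorted_key_list_of_set \<gamma> X) = card X"
proof -
  \<comment> \<open>The labels are injective on \<open>X\<close> only, hence the locale is taken
    with carrier \<open>X\<close>.\<close>
  interpret folding_insort_key less_eq less X \<gamma>
    by unfold_locales (fact assms(2))
  show "set (rev (sorted_key_list_of_set \<gamma> X)) = X"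
    and "sorted_wrt (\<lambda>x y. \<gamma> y < \<gamma> x) (rev (sorted_key_list_of_set \<gamma> X))"
    and "length (sorted_key_list_of_set \<gamma> X) = card X"
    using assms(1) strict_sorted_key_list_of_set[of X]
    by (simp_all add: sorted_wrt_rev sorted_wrt_map)
qed

text \<open>Gives the filling word from any strictly label-decreasing enumeration; reading words and
  disjoint unions come with one.\<close>

lemma (in linorder) rev_sorted_key_list_of_set_unique:
  assumes "sorted_wrt (\<lambda>x y. \<gamma> y < \<gamma> x) xs"
  shows "rev (sorted_key_list_of_set \<gamma> (set xs)) = xs"
proof -
  have less: "sorted_wrt (<) (map \<gamma> (rev xs))"
    using assms by (simp add: sorted_wrt_rev sorted_wrt_map rev_map)
  then have "distinct (map \<gamma> (rev xs))"
    by (simp add: strict_sorted_iff)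
  then have inj: "inj_on \<gamma> (set xs)" and "distinct xs"
    by (simp_all add: distinct_map rev_map)
  interpret folding_insort_key less_eq less "set xs" \<gamma>
    by unfold_locales (fact inj)
  have "sorted_key_list_of_set \<gamma> (set xs) = rev xs"
    using less \<open>distinct xs\<close> sorted_key_list_of_set_unique[of "set xs" "rev xs"]
    by (simp add: distinct_card)
  then show ?thesis
    by simp
qed

lemma filling_word_inj:
  assumes "finite X" "inj_on \<gamma> X"
  shows "inj_on (filling_word X \<gamma>) (extensional X)"
proof (rule inj_onI)
  fix \<sigma> \<tau> :: "'a \<Rightarrow> half"
  assume "\<sigma> \<in> extensional X" "\<tau> \<in> extensional X" "filling_word X \<gamma> \<sigma> = filling_word X \<gamma> \<tau>"
  then show "\<sigma> = \<tau>"
    using rev_sorted_key_list_of_set(1)[OF assms]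
    by (intro extensionalityI) (auto simp: filling_word_def)
qed

text \<open>Nodes are listed by decreasing label, so \<open>u\<close> comes from larger labels and
  \<open>v\<close> from smaller ones. Thus \<open>active_split\<close> is the extremality needed in
  \<open>poset_fillings_update\<close>.\<close>

lemma filling_word_step:
  assumes X: "finite X" "inj_on \<gamma> X" and P: "P \<subseteq> X \<times> X"
    and \<sigma>: "\<sigma> \<in> poset_fillings X P \<gamma>"
    and w: "filling_word X \<gamma> \<sigma> = u @ a # v" and split: "active_split i u v"
    and ab: "active i a" "active i b"
  shows "u @ b # v \<in> filling_word X \<gamma> ` poset_fillings X P \<gamma>"
proof -
  define xs where "xs = rev (sorted_key_list_of_set \<gamma> X)"
  have xs: "set xs = X" "sorted_wrt (\<lambda>x y. \<gamma> y < \<gamma> x) xs"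
    unfolding xs_def using rev_sorted_key_list_of_set[OF X] by auto
  have "map \<sigma> xs = u @ a # v"
    using w by (simp add: filling_word_def xs_def)
  then obtain us x vs where eq: "xs = us @ x # vs" "map \<sigma> us = u" "\<sigma> x = a" "map \<sigma> vs = v"
    by (auto simp: map_eq_append_conv map_eq_Cons_conv)
  have X_eq: "X = insert x (set us \<union> set vs)"
    using xs(1) eq(1) by auto
  have less: "\<forall>z\<in>set us. \<gamma> x < \<gamma> z" "\<forall>z\<in>set vs. \<gamma> z < \<gamma> x"
    using xs(2) unfolding eq(1) by (auto simp: sorted_wrt_append)
  then have "x \<notin> set us" "x \<notin> set vs"
    by auto
  have "\<sigma>(x := b) \<in> poset_fillings X P \<gamma>"
  proof (rule poset_fillings_update[OF \<sigma> P])
    show "x \<in> X" "active i (\<sigma> x)" "active i b"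
      using X_eq ab eq by auto
    show "if is_integer i then \<gamma> z < \<gamma> x else \<gamma> x < \<gamma> z"
      if "z \<in> X" "z \<noteq> x" "active i (\<sigma> z)" for z
      using that split less X_eq unfolding eq(2,4)[symmetric] active_split_def
      by (auto split: if_splits)
  qed
  moreover have "filling_word X \<gamma> (\<sigma>(x := b)) = u @ b # v"
    using \<open>x \<notin> set us\<close> \<open>x \<notin> set vs\<close> eq by (simp add: filling_word_def flip: xs_def)
  ultimately show ?thesis
    by (metis imageI)
qed

lemma elts_poset_crystal [simp]: "elts (\<E> X P \<gamma>) = poset_fillings X P \<gamma>"
  by (simp add: poset_crystal_def embedded_crystal_def)

lemma word_model_poset_crystal:
  assumes "finite X" "inj_on \<gamma> X" "P \<subseteq> X \<times> X"
  shows "word_model (\<E> X P \<gamma>) (filling_word X \<gamma>)"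
  unfolding poset_crystal_def
proof (rule word_model_embedded)
  show "inj_on (filling_word X \<gamma>) (poset_fillings X P \<gamma>)"
    using filling_word_inj[OF assms(1,2)] by (rule inj_on_subset) (auto simp: poset_fillings_def)
  fix i \<sigma> w
  assume \<sigma>: "\<sigma> \<in> poset_fillings X P \<gamma>"
  note step = filling_word_step[OF assms \<sigma>]
  show "w \<in> filling_word X \<gamma> ` poset_fillings X P \<gamma>"
    if e: "word_e i (filling_word X \<gamma> \<sigma>) = Some w"
  proof -
    obtain u v where uv: "filling_word X \<gamma> \<sigma> = u @ half_succ i # v" "w = u @ i # v" "active_split i u v"
      using e by (auto simp: word_e_iff)
    show ?thesis
      unfolding uv(2) by (rule step[OF uv(1,3)]) simp_all
  qed
  show "w \<in> filling_word X \<gamma> ` poset_fillings X P \<gamma>"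
    if f: "word_f i (filling_word X \<gamma> \<sigma>) = Some w"
  proof -
    obtain u v where uv: "filling_word X \<gamma> \<sigma> = u @ i # v" "w = u @ half_succ i # v" "active_split i u v"
      using f by (auto simp: word_f_iff)
    show ?thesis
      unfolding uv(2) by (rule step[OF uv(1,3)]) simp_all
  qed
qed

section \<open>Fillings and linear extensions\<close>

text \<open>The order given by standardizing \<sigma>. Label comparisons are weak because linear
  orders are reflexive here.\<close>

definition filling_order :: "'a set \<Rightarrow> ('a \<Rightarrow> nat) \<Rightarrow> ('a \<Rightarrow> half) \<Rightarrow> 'a rel" where
  "filling_order X \<gamma> \<sigma> = {(x, y) \<in> X \<times> X. \<sigma> x < \<sigma> y \<or>
     \<sigma> x = \<sigma> y \<and> (if is_integer (\<sigma> x) then \<gamma> x \<le> \<gamma> y else \<gamma> y \<le> \<gamma> x)}"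

lemma linear_filling_order:
  assumes "inj_on \<gamma> X"
  shows "linear_order_on X (filling_order X \<gamma> \<sigma>)"
  unfolding linear_order_on_def partial_order_on_def preorder_on_def
proof (intro conjI)
  show "filling_order X \<gamma> \<sigma> \<subseteq> X \<times> X"
    by (auto simp: filling_order_def)
  show "refl_on X (filling_order X \<gamma> \<sigma>)"
    by (auto simp: filling_order_def refl_on_def)
  show "trans (filling_order X \<gamma> \<sigma>)"
  proof (rule transI)
    fix x y z
    assume "(x, y) \<in> filling_order X \<gamma> \<sigma>" "(y, z) \<in> filling_order X \<gamma> \<sigma>"
    then show "(x, z) \<in> filling_order X \<gamma> \<sigma>"
      using less_trans[of "\<sigma> x" "\<sigma> y" "\<sigma> z"]
      by (cases "\<sigma> x = \<sigma> y"; cases "\<sigma> y = \<sigma> z") (simp_all add: filling_order_def split: if_splits)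
  qed
  show "antisym (filling_order X \<gamma> \<sigma>)"
  proof (rule antisymI)
    fix x y
    assume xy: "(x, y) \<in> filling_order X \<gamma> \<sigma>" "(y, x) \<in> filling_order X \<gamma> \<sigma>"
    \<comment> \<open>Comparability both ways forces equal entries, so the same tie rule applies
      twice and the labels agree.\<close>
    then have "\<gamma> x = \<gamma> y"
      using less_asym[of "\<sigma> x" "\<sigma> y"]
      by (cases "\<sigma> x = \<sigma> y") (simp_all add: filling_order_def split: if_splits)
    then show "x = y"
      using assms xy by (auto simp: filling_order_def dest: inj_onD)
  qed
  show "total_on X (filling_order X \<gamma> \<sigma>)"
    unfolding total_on_def
  proof (intro ballI impI)
    fix x y
    assume "x \<in> X" "y \<in> X"
    then show "(x, y) \<in> filling_order X \<gamma> \<sigma> \<or> (y, x) \<in> filling_order X \<gamma> \<sigma>"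
      by (cases "\<sigma> x" "\<sigma> y" rule: linorder_cases) (simp_all add: filling_order_def linear)
  qed
qed

text \<open>For distinct nodes, injective labels turn the weak tie-break of
  \<open>filling_order\<close> into the strict one of fillings, so both sides impose the same
  condition on each pair of \<open>P\<close>.\<close>

lemma poset_fillings_iff_subset_filling_order:
  assumes "inj_on \<gamma> X" "P \<subseteq> X \<times> X"
  shows "\<sigma> \<in> poset_fillings X P \<gamma> \<longleftrightarrow> \<sigma> \<in> extensional X \<and> P \<subseteq> filling_order X \<gamma> \<sigma>"
proof
  assume \<sigma>: "\<sigma> \<in> poset_fillings X P \<gamma>"
  have "(x, y) \<in> filling_order X \<gamma> \<sigma>" if "(x, y) \<in> P" for x y
    using that assms(2) poset_fillingsD[OF \<sigma> that]
    by (cases "x = y") (auto simp: filling_order_def order_le_less)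
  then show "\<sigma> \<in> extensional X \<and> P \<subseteq> filling_order X \<gamma> \<sigma>"
    using \<sigma> by (auto simp: poset_fillings_def)
next
  assume \<sigma>: "\<sigma> \<in> extensional X \<and> P \<subseteq> filling_order X \<gamma> \<sigma>"
  have "\<gamma> x \<noteq> \<gamma> y" "(x, y) \<in> filling_order X \<gamma> \<sigma>" if "(x, y) \<in> P" "x \<noteq> y" for x y
    using that assms \<sigma> by (auto dest: inj_onD)
  then show "\<sigma> \<in> poset_fillings X P \<gamma>"
    using \<sigma> unfolding poset_fillings_def filling_order_def
    by (fastforce split: if_splits)
qed

text \<open>A pair of \<open>s\<close> missing from \<open>r\<close> would have its converse in
  \<open>r\<close> by totality, against antisymmetry of \<open>s\<close>.\<close>

lemma linear_order_on_subset_eq: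
  assumes r: "linear_order_on A r" and s: "linear_order_on A s" and "r \<subseteq> s"
  shows "r = s"
proof
  show "s \<subseteq> r"
  proof clarify
    fix x y
    assume xy: "(x, y) \<in> s"
    then have "x \<in> A" "y \<in> A"
      using s by (auto simp: order_on_defs)
    then have "(x, y) \<in> r \<or> (y, x) \<in> r"
      using r by (cases "x = y") (auto simp: order_on_defs total_on_def refl_on_def)
    then show "(x, y) \<in> r"
    proof
      assume "(y, x) \<in> r"
      then have "x = y"
        using \<open>r \<subseteq> s\<close> xy s by (auto simp: order_on_defs dest: antisymD)
      then show ?thesis
        using \<open>(y, x) \<in> r\<close> by simp
    qed
  qed
qed fact

lemma linear_extensions_subset: "w \<in> linear_extensions X P \<Longrightarrow> w \<subseteq> X \<times> X"
  by (auto simp: linear_extensions_def order_on_defs)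

text \<open>Both orders are linear, so containment of \<open>w\<close> in
  \<open>filling_order\<close> is already equality; hence a filling belongs to only one linear
  extension.\<close>

lemma poset_fillings_linear_extension_iff:
  assumes inj: "inj_on \<gamma> X" and w: "w \<in> linear_extensions X P"
  shows "\<sigma> \<in> poset_fillings X w \<gamma> \<longleftrightarrow> \<sigma> \<in> extensional X \<and> w = filling_order X \<gamma> \<sigma>"
  using poset_fillings_iff_subset_filling_order[OF inj linear_extensions_subset[OF w]]
    linear_order_on_subset_eq[OF _ linear_filling_order[OF inj]] w
  by (auto simp: linear_extensions_def)

text \<open>The fundamental lemma of P-partitions; the linear extension attached to a filling is its
  \<open>filling_order\<close>.\<close>

lemma poset_fillings_eq_UN_linear_extensions:
  assumes "inj_on \<gamma> X" "P \<subseteq> X \<times> X"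
  shows "poset_fillings X P \<gamma> = (\<Union>w\<in>linear_extensions X P. poset_fillings X w \<gamma>)"
proof -
  have "\<sigma> \<in> poset_fillings X P \<gamma> \<longleftrightarrow>
      \<sigma> \<in> extensional X \<and> filling_order X \<gamma> \<sigma> \<in> linear_extensions X P" for \<sigma>
    using poset_fillings_iff_subset_filling_order[OF assms] linear_filling_order[OF assms(1)]
    by (simp add: linear_extensions_def)
  moreover have "\<sigma> \<in> poset_fillings X w \<gamma> \<longleftrightarrow> \<sigma> \<in> extensional X \<and> w = filling_order X \<gamma> \<sigma>"
    if "w \<in> linear_extensions X P" for w \<sigma>
    using poset_fillings_linear_extension_iff[OF assms(1) that] .
  ultimately show ?thesis
    by (intro set_eqI) simp
qed

lemma word_model_linear_extensions:
  assumes X: "finite X" "inj_on \<gamma> X"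
  shows "word_model (crystal_sum (linear_extensions X P) (\<lambda>w. \<E> X w \<gamma>)) (filling_word X \<gamma> \<circ> snd)"
proof (rule word_model_sum)
  fix w w' \<sigma> \<sigma>'
  assume w: "w \<in> linear_extensions X P"
  then show "word_model (\<E> X w \<gamma>) (filling_word X \<gamma>)"
    by (intro word_model_poset_crystal X linear_extensions_subset)
  assume "w' \<in> linear_extensions X P" "\<sigma> \<in> elts (\<E> X w \<gamma>)" "\<sigma>' \<in> elts (\<E> X w' \<gamma>)"
    "filling_word X \<gamma> \<sigma> = filling_word X \<gamma> \<sigma>'"
  then have "\<sigma> \<in> extensional X" "w = filling_order X \<gamma> \<sigma>"
    "\<sigma>' \<in> extensional X" "w' = filling_order X \<gamma> \<sigma>'"
    using poset_fillings_linear_extension_iff[OF X(2) w]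
      poset_fillings_linear_extension_iff[OF X(2), of w' P] by auto
  \<comment> \<open>Equal words give equal fillings, and a filling determines its order.\<close>
  moreover from this have "\<sigma> = \<sigma>'"
    using filling_word_inj[OF X] \<open>filling_word X \<gamma> \<sigma> = filling_word X \<gamma> \<sigma>'\<close>
    by (meson inj_onD)
  ultimately show "w = w'"
    by simp
qed

lemma image_word_linear_extensions:
  assumes "inj_on \<gamma> X" "P \<subseteq> X \<times> X"
  shows "(filling_word X \<gamma> \<circ> snd) ` elts (crystal_sum (linear_extensions X P) (\<lambda>w. \<E> X w \<gamma>)) =
    filling_word X \<gamma> ` poset_fillings X P \<gamma>"
proof -
  have "snd ` Sigma L A = (\<Union>w\<in>L. A w)" for L :: "'a rel set" and A :: "'a rel \<Rightarrow> ('a \<Rightarrow> half) set"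
    by force
  then show ?thesis
    unfolding poset_fillings_eq_UN_linear_extensions[OF assms]
    by (simp only: image_comp[symmetric] crystal_sum_def crystal.simps elts_poset_crystal)
qed

section \<open>Disjoint unions of posets and tensor products\<close>

lemma case_sum_poset_fillings_iff:
  "case_sum b c \<in> poset_fillings (X <+> Y) (poset_union P Q) (case_sum \<gamma> \<delta>) \<longleftrightarrow>
     b \<in> poset_fillings X P \<gamma> \<and> c \<in> poset_fillings Y Q \<delta>"
proof -
  have "case_sum b c \<in> extensional (X <+> Y) \<longleftrightarrow> b \<in> extensional X \<and> c \<in> extensional Y"
    by (auto simp: extensional_def split: sum.splits)
  \<comment> \<open>No pair of the disjoint union joins the two summands, so any condition on pairs
    splits.\<close>
  moreover have "(\<forall>x y. (x, y) \<in> poset_union P Q \<and> x \<noteq> y \<longrightarrow> R x y) \<longleftrightarrow>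
      (\<forall>x y. (x, y) \<in> P \<and> x \<noteq> y \<longrightarrow> R (Inl x) (Inl y)) \<and>
      (\<forall>x y. (x, y) \<in> Q \<and> x \<noteq> y \<longrightarrow> R (Inr x) (Inr y))" for R
    by (auto simp: poset_union_def)
  ultimately show ?thesis
    unfolding poset_fillings_def by auto
qed

text \<open>By \<open>less\<close>, the decreasing enumeration of \<open>X\<close> followed by that
  of \<open>Y\<close> is again decreasing, hence the one that \<open>filling_word\<close>
  uses.\<close>

lemma filling_word_case_sum:
  assumes X: "finite X" "inj_on \<gamma> X" and Y: "finite Y" "inj_on \<delta> Y"
    and less: "\<And>x y. x \<in> X \<Longrightarrow> y \<in> Y \<Longrightarrow> \<delta> y < \<gamma> x"
  shows "filling_word (X <+> Y) (case_sum \<gamma> \<delta>) (case_sum b c) = filling_word X \<gamma> b @ filling_word Y \<delta> c"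
proof -
  define xs ys where "xs = rev (sorted_key_list_of_set \<gamma> X)" and "ys = rev (sorted_key_list_of_set \<delta> Y)"
  have xs: "set xs = X" "sorted_wrt (\<lambda>x y. \<gamma> y < \<gamma> x) xs"
    unfolding xs_def using rev_sorted_key_list_of_set[OF X] by auto
  have ys: "set ys = Y" "sorted_wrt (\<lambda>x y. \<delta> y < \<delta> x) ys"
    unfolding ys_def using rev_sorted_key_list_of_set[OF Y] by auto
  have "set (map Inl xs @ map Inr ys) = X <+> Y"
    using xs ys by auto
  moreover have "sorted_wrt (\<lambda>x y. case_sum \<gamma> \<delta> y < case_sum \<gamma> \<delta> x) (map Inl xs @ map Inr ys)"
    using xs ys less by (auto simp: sorted_wrt_append sorted_wrt_map)
  ultimately have "rev (sorted_key_list_of_set (case_sum \<gamma> \<delta>) (X <+> Y)) = map Inl xs @ map Inr ys"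
    using rev_sorted_key_list_of_set_unique[of "case_sum \<gamma> \<delta>" "map Inl xs @ map Inr ys"] by simp
  then show ?thesis
    by (simp add: filling_word_def xs_def ys_def)
qed

text \<open>The decomposition for arbitrary labelled posets, of which two ribbon chains are a case.
  On each side the words are those of the fillings of the disjoint union.\<close>

theorem poset_crystal_tensor:
  assumes X: "finite X" "inj_on \<gamma> X" "P \<subseteq> X \<times> X" and Y: "finite Y" "inj_on \<delta> Y" "Q \<subseteq> Y \<times> Y"
    and less: "\<And>x y. x \<in> X \<Longrightarrow> y \<in> Y \<Longrightarrow> \<delta> y < \<gamma> x"
  shows "\<E> X P \<gamma> \<otimes>\<^sub>c \<E> Y Q \<delta> \<simeq>\<^sub>c
    crystal_sum (linear_extensions (X <+> Y) (poset_union P Q)) (\<lambda>w. \<E> (X <+> Y) w (case_sum \<gamma> \<delta>))"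
proof (rule word_models_isomorphic)
  let ?Z = "X <+> Y" and ?\<zeta> = "case_sum \<gamma> \<delta>"
  have "inj_on ?\<zeta> (Inl ` X)" "inj_on ?\<zeta> (Inr ` Y)"
    by (rule inj_on_imageI; simp add: comp_def X(2) Y(2))+
  moreover have "?\<zeta> ` Inl ` X \<inter> ?\<zeta> ` Inr ` Y = {}"
  proof -
    have "\<gamma> x \<noteq> \<delta> y" if "x \<in> X" "y \<in> Y" for x y
      using less[OF that] by simp
    then show ?thesis
      by auto
  qed
  ultimately have "inj_on ?\<zeta> ?Z"
    unfolding Plus_def inj_on_Un by blast
  moreover have "poset_union P Q \<subseteq> ?Z \<times> ?Z"
    using X(3) Y(3) by (auto simp: poset_union_def)
  ultimately have Z: "finite ?Z" "inj_on ?\<zeta> ?Z" "poset_union P Q \<subseteq> ?Z \<times> ?Z"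
    using X(1) Y(1) by simp_all
  show "word_model (\<E> X P \<gamma> \<otimes>\<^sub>c \<E> Y Q \<delta>) (\<lambda>(b, c). filling_word X \<gamma> b @ filling_word Y \<delta> c)"
  proof (rule word_model_tensor)
    show "length (filling_word X \<gamma> b) = card X" for b
      using rev_sorted_key_list_of_set(3)[OF X(1,2)] by (simp add: filling_word_def)
  qed (intro word_model_poset_crystal X Y)+
  show "word_model (crystal_sum (linear_extensions ?Z (poset_union P Q)) (\<lambda>w. \<E> ?Z w ?\<zeta>))
      (filling_word ?Z ?\<zeta> \<circ> snd)"
    by (intro word_model_linear_extensions Z)
  \<comment> \<open>A function on a sum type is the \<open>case_sum\<close> of its restrictions, so
    a filling of the union amounts to a pair of fillings.\<close>
  have "poset_fillings ?Z (poset_union P Q) ?\<zeta> =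
      case_prod case_sum ` (poset_fillings X P \<gamma> \<times> poset_fillings Y Q \<delta>)"
  proof (intro equalityI subsetI)
    fix \<sigma>
    assume "\<sigma> \<in> poset_fillings ?Z (poset_union P Q) ?\<zeta>"
    moreover have \<sigma>: "case_sum (\<sigma> \<circ> Inl) (\<sigma> \<circ> Inr) = \<sigma>"
      unfolding comp_def by (rule surjective_sum)
    ultimately have "(\<sigma> \<circ> Inl, \<sigma> \<circ> Inr) \<in> poset_fillings X P \<gamma> \<times> poset_fillings Y Q \<delta>"
      using case_sum_poset_fillings_iff[of "\<sigma> \<circ> Inl" "\<sigma> \<circ> Inr"] by (simp only: \<sigma> mem_Times_iff fst_conv snd_conv)
    then show "\<sigma> \<in> case_prod case_sum ` (poset_fillings X P \<gamma> \<times> poset_fillings Y Q \<delta>)"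
      by (rule rev_image_eqI) (simp only: case_prod_conv \<sigma>)
  qed (auto simp: case_sum_poset_fillings_iff)
  then show "(\<lambda>(b, c). filling_word X \<gamma> b @ filling_word Y \<delta> c) ` elts (\<E> X P \<gamma> \<otimes>\<^sub>c \<E> Y Q \<delta>) =
      (filling_word ?Z ?\<zeta> \<circ> snd) ` elts (crystal_sum (linear_extensions ?Z (poset_union P Q)) (\<lambda>w. \<E> ?Z w ?\<zeta>))"
    unfolding image_word_linear_extensions[OF Z(2,3)]
    by (simp add: crystal_tensor_def image_image case_prod_unfold
        filling_word_case_sum[OF X(1,2) Y(1,2) less])
qed

section \<open>Quasi-ribbon tableaux as fillings of a chain\<close>

lemma ribbon_start_Suc: "ribbon_start \<alpha> (Suc i) = ribbon_start \<alpha> i + (\<alpha> ! i - 1)"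
  by (simp add: ribbon_start_def)

lemma ribbon_start_mono: "i \<le> i' \<Longrightarrow> ribbon_start \<alpha> i \<le> ribbon_start \<alpha> i'"
  by (rule lift_Suc_mono_le[of "ribbon_start \<alpha>"]) (simp_all add: ribbon_start_Suc)

text \<open>Positive parts make the truncated subtraction in \<open>ribbon_start\<close> exact, so
  row \<open>i\<close> ends in column \<open>ribbon_start \<alpha> (Suc i)\<close>.\<close>

lemma mem_ribbon_iff:
  assumes "is_composition \<alpha> r"
  shows "(i, j) \<in> ribbon \<alpha> \<longleftrightarrow>
    i < length \<alpha> \<and> ribbon_start \<alpha> i \<le> j \<and> j \<le> ribbon_start \<alpha> (Suc i)"
proof -
  have "0 < \<alpha> ! i" if "i < length \<alpha>"
    using assms that by (auto simp: is_composition_def)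
  then show ?thesis
    by (auto simp: ribbon_def ribbon_row_def ribbon_start_Suc) force+
qed

section \<open>Reading order and labels of a ribbon\<close>

definition read_before :: "node \<Rightarrow> node \<Rightarrow> bool" where
  "read_before x y \<longleftrightarrow> fst x < fst y \<or> fst x = fst y \<and> snd y < snd x"

lemma sorted_reading_nodes: "sorted_wrt read_before (reading_nodes \<alpha>)"
proof -
  have row: "sorted_wrt read_before (rev (ribbon_row \<alpha> i))" for i
    by (simp add: ribbon_row_def sorted_wrt_rev sorted_wrt_map read_before_def)
  have "sorted_wrt read_before (concat (map (\<lambda>i. rev (ribbon_row \<alpha> i)) [0..<n]))" for n
    by (induction n) (auto simp: sorted_wrt_append row, auto simp: ribbon_row_def read_before_def)
  then show ?thesis
    by (simp add: reading_nodes_def)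
qed

lemma distinct_reading_nodes: "distinct (reading_nodes \<alpha>)"
proof -
  have "reading_nodes \<alpha> ! k \<noteq> reading_nodes \<alpha> ! l"
    if "k < l" "l < length (reading_nodes \<alpha>)" for k l
    using sorted_wrt_nth_less[OF sorted_reading_nodes that] by (auto simp: read_before_def)
  then show ?thesis
    unfolding distinct_conv_nth by (metis nat_neq_iff)
qed

lemma set_reading_nodes: "set (reading_nodes \<alpha>) = ribbon \<alpha>"
  by (auto simp: reading_nodes_def ribbon_def)

lemma length_reading_nodes: "length (reading_nodes \<alpha>) = sum_list \<alpha>"
  by (simp add: reading_nodes_def length_concat comp_def ribbon_row_def map_nth)

text \<open>Positions count from 0 in the list and from 1 in \<open>ribbon_label\<close>, which
  absorbs the summand 1; distinctness of the nodes makes the description unique.\<close>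

lemma ribbon_label_nth:
  assumes "k < sum_list \<alpha>"
  shows "ribbon_label \<alpha> (reading_nodes \<alpha> ! k) = sum_list \<alpha> - k"
  unfolding ribbon_label_def Let_def
proof (rule the_equality)
  show "\<exists>k'\<in>{1..sum_list \<alpha>}. reading_nodes \<alpha> ! (k' - 1) = reading_nodes \<alpha> ! k \<and>
      sum_list \<alpha> - k = sum_list \<alpha> - k' + 1"
    using assms by (intro bexI[of _ "Suc k"]) auto
  show "l = sum_list \<alpha> - k"
    if "\<exists>k'\<in>{1..sum_list \<alpha>}. reading_nodes \<alpha> ! (k' - 1) = reading_nodes \<alpha> ! k \<and>
      l = sum_list \<alpha> - k' + 1" for l
  proof -
    from that obtain k' where k': "k' \<in> {1..sum_list \<alpha>}"
      "reading_nodes \<alpha> ! (k' - 1) = reading_nodes \<alpha> ! k" "l = sum_list \<alpha> - k' + 1"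
      by blast
    then have "k' - 1 = k"
      using assms distinct_reading_nodes[of \<alpha>]
      by (subst (asm) nth_eq_iff_index_eq) (auto simp: length_reading_nodes)
    then show ?thesis
      using k' by auto
  qed
qed

lemma ribbon_label_bounds:
  assumes "x \<in> ribbon \<alpha>"
  shows "0 < ribbon_label \<alpha> x" "ribbon_label \<alpha> x \<le> sum_list \<alpha>"
proof -
  obtain k where "k < sum_list \<alpha>" "x = reading_nodes \<alpha> ! k"
    using assms unfolding set_reading_nodes[symmetric] length_reading_nodes[symmetric] in_set_conv_nth
    by blast
  then show "0 < ribbon_label \<alpha> x" "ribbon_label \<alpha> x \<le> sum_list \<alpha>"
    by (simp_all add: ribbon_label_nth)
qed

lemma sorted_reading_nodes_label:
  "sorted_wrt (\<lambda>x y. ribbon_label \<alpha> y < ribbon_label \<alpha> x) (reading_nodes \<alpha>)"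
  by (auto simp: sorted_wrt_iff_nth_less length_reading_nodes ribbon_label_nth)

lemma ribbon_label_less:
  assumes "x \<in> ribbon \<alpha>" "y \<in> ribbon \<alpha>" "read_before x y"
  shows "ribbon_label \<alpha> y < ribbon_label \<alpha> x"
proof -
  obtain k l where kl: "k < sum_list \<alpha>" "x = reading_nodes \<alpha> ! k" "l < sum_list \<alpha>" "y = reading_nodes \<alpha> ! l"
    using assms(1,2)
    unfolding set_reading_nodes[symmetric] length_reading_nodes[symmetric] in_set_conv_nth by blast
  have "\<not> l < k" "l \<noteq> k"
    using sorted_wrt_nth_less[OF sorted_reading_nodes, of l k \<alpha>] kl assms(3)
    by (auto simp: length_reading_nodes read_before_def)
  then show ?thesis
    using kl by (simp add: ribbon_label_nth)
qed

lemma inj_on_ribbon_label: "inj_on (ribbon_label \<alpha>) (ribbon \<alpha>)"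
proof (rule inj_onI, rule ccontr)
  fix x y
  assume xy: "x \<in> ribbon \<alpha>" "y \<in> ribbon \<alpha>" "ribbon_label \<alpha> x = ribbon_label \<alpha> y" "x \<noteq> y"
  then have "read_before x y \<or> read_before y x"
    by (cases x; cases y) (auto simp: read_before_def)
  then show False
    using xy ribbon_label_less by fastforce
qed

lemma quasi_ribbon_tableauxD:
  assumes "T \<in> quasi_ribbon_tableaux \<alpha>"
  shows "(i, j) \<in> ribbon \<alpha> \<Longrightarrow> (i, j') \<in> ribbon \<alpha> \<Longrightarrow> j < j' \<Longrightarrow>
      T (i, j) \<le> T (i, j') \<and> (\<not> is_integer (T (i, j)) \<longrightarrow> T (i, j) \<noteq> T (i, j'))"
    and "(i, j) \<in> ribbon \<alpha> \<Longrightarrow> (i', j) \<in> ribbon \<alpha> \<Longrightarrow> i < i' \<Longrightarrow>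
      T (i, j) \<le> T (i', j) \<and> (is_integer (T (i, j)) \<longrightarrow> T (i, j) \<noteq> T (i', j))"
  using assms unfolding quasi_ribbon_tableaux_def by blast+

text \<open>Between two nodes in different rows and different columns the ribbon makes both a horizontal
  and a vertical step, so equality of their entries would contradict one of the two strictness
  conditions.\<close>

lemma quasi_ribbon_tableaux_rows:
  assumes \<alpha>: "is_composition \<alpha> r" and T: "T \<in> quasi_ribbon_tableaux \<alpha>"
    and "(i, j) \<in> ribbon \<alpha>" "(i', j') \<in> ribbon \<alpha>" "i < i'"
  shows "T (i, j) \<le> T (i', j') \<and> (j < j' \<longrightarrow> T (i, j) < T (i', j'))"
  using assms(3-5)
proof (induction "i' - i" arbitrary: i j)
  case 0
  then show ?case by simp
next
  case (Suc d)
  \<comment> \<open>The corner column: \<open>(i, e)\<close> ends its row and lies directly above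
    the first node of the next row. The path to \<open>(i', j')\<close> is cut at these two
    nodes.\<close>
  define e where "e = ribbon_start \<alpha> (Suc i)"
  have e: "j \<le> e" "(i, e) \<in> ribbon \<alpha>" "(Suc i, e) \<in> ribbon \<alpha>"
    using Suc.prems ribbon_start_mono[of i "Suc i" \<alpha>] ribbon_start_mono[of "Suc i" "Suc (Suc i)" \<alpha>]
    by (auto simp: mem_ribbon_iff[OF \<alpha>] e_def)
  have row: "T (i, j) \<le> T (i, e)" "j < e \<Longrightarrow> \<not> is_integer (T (i, j)) \<Longrightarrow> T (i, j) \<noteq> T (i, e)"
    using quasi_ribbon_tableauxD(1)[OF T Suc.prems(1) e(2)] e(1) by (cases "j = e"; simp)+
  have column: "T (i, e) \<le> T (Suc i, e)" "is_integer (T (i, e)) \<Longrightarrow> T (i, e) \<noteq> T (Suc i, e)"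
    using quasi_ribbon_tableauxD(2)[OF T e(2,3)] by auto
  \<comment> \<open>This weaker claim also covers a target in row \<open>Suc i\<close>, by the row
    condition; for lower rows it follows from the induction hypothesis.\<close>
  have rest: "T (Suc i, e) \<le> T (i', j')"
    "e < j' \<Longrightarrow> \<not> is_integer (T (Suc i, e)) \<Longrightarrow> T (Suc i, e) \<noteq> T (i', j')"
  proof -
    have "T (Suc i, e) \<le> T (i', j') \<and>
      (e < j' \<longrightarrow> \<not> is_integer (T (Suc i, e)) \<longrightarrow> T (Suc i, e) \<noteq> T (i', j'))"
    proof (cases "Suc i = i'")
      case True
      then have "e \<le> j'"
        using Suc.prems(2) by (auto simp: mem_ribbon_iff[OF \<alpha>] e_def)
      then show ?thesis
        using quasi_ribbon_tableauxD(1)[OF T e(3), of j'] Suc.prems(2) True by (cases "e = j'") auto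
    next
      case False
      moreover have "d = i' - Suc i"
        using Suc.hyps(2) by simp
      ultimately show ?thesis
        using Suc.hyps(1)[OF _ e(3) Suc.prems(2)] Suc.prems(3) by auto
    qed
    then show "T (Suc i, e) \<le> T (i', j')"
      "e < j' \<Longrightarrow> \<not> is_integer (T (Suc i, e)) \<Longrightarrow> T (Suc i, e) \<noteq> T (i', j')"
      by auto
  qed
  have "T (i, j) < T (i', j')" if "j < j'"
  proof (rule ccontr)
    assume "\<not> T (i, j) < T (i', j')"
    then have eq: "T (i, j) = T (i, e)" "T (i, e) = T (Suc i, e)" "T (Suc i, e) = T (i', j')"
      using row(1) column(1) rest(1) by auto
    \<comment> \<open>A horizontal move occurs before or after the corner; a common entry violates
      the column condition if integral and a row condition otherwise.\<close>
    have "j < e \<or> e < j'"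
      using that e(1) by auto
    then show False
      using row(2) column(2) rest(2) eq by auto
  qed
  then show ?case
    using row(1) column(1) rest(1) by auto
qed

text \<open>Labels grow to the right along rows and shrink down columns, so the tie rules of
  fillings become the strictness conditions of tableaux. Shifting all labels by \<open>t\<close>
  changes no comparison.\<close>

lemma quasi_ribbon_tableaux_eq_poset_fillings:
  assumes \<alpha>: "is_composition \<alpha> r"
  shows "quasi_ribbon_tableaux \<alpha> =
    poset_fillings (ribbon \<alpha>) (ribbon_chain \<alpha>) (shift_label t (ribbon_label \<alpha>))"
proof (intro equalityI subsetI)
  fix T
  assume T: "T \<in> quasi_ribbon_tableaux \<alpha>"
  have "T x \<le> T y \<and>
      (T x = T y \<longrightarrow> (if is_integer (T x) then ribbon_label \<alpha> x < ribbon_label \<alpha> y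
        else ribbon_label \<alpha> y < ribbon_label \<alpha> x))"
    if "(x, y) \<in> ribbon_chain \<alpha>" "x \<noteq> y" for x y
  proof -
    obtain i j i' j' where [simp]: "x = (i, j)" "y = (i', j')"
      by (cases x; cases y)
    have mem: "(i, j) \<in> ribbon \<alpha>" "(i', j') \<in> ribbon \<alpha>" and le: "i \<le> i'" "j \<le> j'"
      using that by (auto simp: ribbon_chain_def)
    consider "i = i'" "j < j'" | "i < i'" "j = j'" | "i < i'" "j < j'"
      using le \<open>x \<noteq> y\<close> by fastforce
    then show ?thesis
    proof cases
      case 1
      then show ?thesis
        using quasi_ribbon_tableauxD(1)[OF T, of i j j'] mem ribbon_label_less[OF mem(2,1)]
        by (auto simp: read_before_def)
    next
      case 2
      then show ?thesis
        using quasi_ribbon_tableauxD(2)[OF T, of i j i'] mem ribbon_label_less[OF mem]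
        by (auto simp: read_before_def)
    next
      case 3
      then show ?thesis
        using quasi_ribbon_tableaux_rows[OF \<alpha> T mem] by auto
    qed
  qed
  then show "T \<in> poset_fillings (ribbon \<alpha>) (ribbon_chain \<alpha>) (shift_label t (ribbon_label \<alpha>))"
    using T by (auto simp: poset_fillings_def shift_label_def quasi_ribbon_tableaux_def)
next
  fix T
  assume T: "T \<in> poset_fillings (ribbon \<alpha>) (ribbon_chain \<alpha>) (shift_label t (ribbon_label \<alpha>))"
  have "T (i, j) \<le> T (i, j') \<and> (\<not> is_integer (T (i, j)) \<longrightarrow> T (i, j) \<noteq> T (i, j'))"
    if "(i, j) \<in> ribbon \<alpha>" "(i, j') \<in> ribbon \<alpha>" "j < j'" for i j j'
    using that poset_fillingsD[OF T, of "(i, j)" "(i, j')"] ribbon_label_less[OF that(2,1)]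
    by (auto simp: ribbon_chain_def shift_label_def read_before_def)
  moreover have "T (i, j) \<le> T (i', j) \<and> (is_integer (T (i, j)) \<longrightarrow> T (i, j) \<noteq> T (i', j))"
    if "(i, j) \<in> ribbon \<alpha>" "(i', j) \<in> ribbon \<alpha>" "i < i'" for i i' j
    using that poset_fillingsD[OF T, of "(i, j)" "(i', j)"] ribbon_label_less[OF that(1,2)]
    by (auto simp: ribbon_chain_def shift_label_def read_before_def)
  moreover have "T \<in> extensional (ribbon \<alpha>)"
    using T by (simp add: poset_fillings_def)
  ultimately show "T \<in> quasi_ribbon_tableaux \<alpha>"
    unfolding quasi_ribbon_tableaux_def by blast
qed

text \<open>An equality, not just an isomorphism, since fillings and words coincide. The free shift
  \<open>t\<close> serves both factors, with \<open>s\<close> for \<alpha> and 0 for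
  \<beta>.\<close>

lemma ribbon_crystal_eq_poset_crystal:
  assumes "is_composition \<alpha> r"
  shows "\<^bold>B \<alpha> = \<E> (ribbon \<alpha>) (ribbon_chain \<alpha>) (shift_label t (ribbon_label \<alpha>))"
proof -
  have "sorted_wrt (\<lambda>x y. shift_label t (ribbon_label \<alpha>) y < shift_label t (ribbon_label \<alpha>) x)
      (reading_nodes \<alpha>)"
    using sorted_reading_nodes_label by (simp add: shift_label_def)
  then have "tableau_word \<alpha> = filling_word (ribbon \<alpha>) (shift_label t (ribbon_label \<alpha>))"
    unfolding tableau_word_def[abs_def] filling_word_def[abs_def] set_reading_nodes[symmetric]
    by (subst rev_sorted_key_list_of_set_unique) auto
  then show ?thesis
    unfolding ribbon_crystal_def poset_crystal_def
      quasi_ribbon_tableaux_eq_poset_fillings[OF assms, of t] by simp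
qed

theorem proposition4p7:
  fixes \<alpha> \<beta> :: "nat list" and r s :: nat
  assumes "is_composition \<alpha> r" and "is_composition \<beta> s"
  shows "\<^bold>B \<alpha> \<otimes>\<^sub>c \<^bold>B \<beta> \<simeq>\<^sub>c
    crystal_sum
      (linear_extensions (ribbon \<alpha> <+> ribbon \<beta>)
         (poset_union (ribbon_chain \<alpha>) (ribbon_chain \<beta>)))
      (\<lambda>w. \<E> (ribbon \<alpha> <+> ribbon \<beta>) w
         (case_sum (shift_label s (ribbon_label \<alpha>)) (ribbon_label \<beta>)))"
proof -
  have "\<^bold>B \<beta> = \<E> (ribbon \<beta>) (ribbon_chain \<beta>) (ribbon_label \<beta>)"
    using ribbon_crystal_eq_poset_crystal[OF assms(2), of 0] by (simp add: shift_label_def[abs_def])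
  moreover have "\<^bold>B \<alpha> = \<E> (ribbon \<alpha>) (ribbon_chain \<alpha>) (shift_label s (ribbon_label \<alpha>))"
    using assms(1) by (rule ribbon_crystal_eq_poset_crystal)
  moreover have "finite (ribbon \<gamma>)" for \<gamma>
    unfolding set_reading_nodes[symmetric] by simp
  moreover have "ribbon_chain \<gamma> \<subseteq> ribbon \<gamma> \<times> ribbon \<gamma>" for \<gamma>
    by (auto simp: ribbon_chain_def)
  moreover have "inj_on (shift_label s (ribbon_label \<alpha>)) (ribbon \<alpha>)"
    using inj_on_ribbon_label by (auto simp: inj_on_def shift_label_def)
  \<comment> \<open>Labels of \<beta> are at most \<open>s\<close>, and shifted labels of \<alpha>
    exceed \<open>s\<close> because labels are positive.\<close>
  moreover have "ribbon_label \<beta> y < shift_label s (ribbon_label \<alpha>) x"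
    if "x \<in> ribbon \<alpha>" "y \<in> ribbon \<beta>" for x y
    using that ribbon_label_bounds[of x \<alpha>] ribbon_label_bounds[of y \<beta>] assms(2)
    by (simp add: shift_label_def is_composition_def)
  ultimately show ?thesis
    using inj_on_ribbon_label by (simp only:) (rule poset_crystal_tensor)
qed

end
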